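(* Suppose that $(Z,d_Z)$ is a $\kappa$-uniformly perfect metric space with $\kappa>1$ and that $f:(Z,d_Z)\to(W,d_W)$ is $\eta$-quasisymmetric. If $f$ is $r$-uniformly bounded for some $r$ with $0<r<2\,\mathrm{diam}\, Z$, then $f$ is $s$-uniformly bounded for every $s\in(0,2\,\mathrm{diam}\, Z)$.
   Context: All metric spaces contain at least two points. $\mathrm{diam}\, A=\sup\{d(z_1,z_2): z_1,z_2\in A\}$ for a subset $A$ of a metric space, and $\mathrm{diam}\, Z=\infty$ if $Z$ is unbounded. $B(x,r)=\{y\in Z: d_Z(y,x)<r\}$ denotes the open ball. Uniform perfectness: $(Z,d_Z)$ is $\kappa$-uniformly perfect ($\kappa>1$) if for each $x\in Z$ and each $\rho>0$, the set $B(x,\rho)\setminus B(x,\rho/\kappa)$ is nonempty whenever $Z\setminus B(x,\rho)$ is nonempty. Quasisymmetry: a homeomorphism $f:(Z,d_Z)\to(W,d_W)$ is $\eta$-quasisymmetric if $\eta$ is a self-homeomorphism of $[0,+\infty)$ such that $\frac{d_W(f(x),f(z))}{d_W(f(y),f(z))}\leq \eta\left(\frac{d_Z(x,z)}{d_Z(y,z)}\right)$ for all $x,y,z\in Z$ with $y\neq z$. Uniform boundedness: for $0<r<2\,\mathrm{diam}\, Z$, a homeomorphism $f:(Z,d_Z)\to(W,d_W)$ is $r$-uniformly bounded if there are constants $0<a<b$ such that $a\leq \mathrm{diam}\, f(B(x,r))\leq b$ for all $x\in Z$. *)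

theory Defs
  imports "HOL-Analysis.Analysis"
begin

text \<open>Metric spaces are given by a carrier set and a distance function, as in the locale
  \<^locale>\<open>Metric_space\<close>; the constants below are meaningful under that assumption.\<close>

text \<open>The diameter takes values in \<^typ>\<open>ennreal\<close> so that it is infinite for unbounded sets,
  which the real-valued library constant \<^const>\<open>diameter\<close> cannot express.\<close>

definition ediam :: "('a \<Rightarrow> 'a \<Rightarrow> real) \<Rightarrow> 'a set \<Rightarrow> ennreal" where
  "ediam d A = (SUP (x, y) \<in> A \<times> A. ennreal (d x y))"

definition uniformly_perfect :: "'a set \<Rightarrow> ('a \<Rightarrow> 'a \<Rightarrow> real) \<Rightarrow> real \<Rightarrow> bool" where
  "uniformly_perfect Z d \<kappa> \<longleftrightarrow>
     (\<forall>x\<in>Z. \<forall>\<rho>>0. Z - Metric_space.mball Z d x \<rho> \<noteq> {} \<longrightarrow>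
        Metric_space.mball Z d x \<rho> - Metric_space.mball Z d x (\<rho> / \<kappa>) \<noteq> {})"

text \<open>Only the values of \<open>\<eta>\<close> on \<open>[0, \<infinity>)\<close> matter.  By injectivity of \<open>f\<close>, the denominators
  do not vanish.\<close>

definition quasisymmetric ::
  "'a set \<Rightarrow> ('a \<Rightarrow> 'a \<Rightarrow> real) \<Rightarrow> 'b set \<Rightarrow> ('b \<Rightarrow> 'b \<Rightarrow> real) \<Rightarrow> (real \<Rightarrow> real) \<Rightarrow> ('a \<Rightarrow> 'b) \<Rightarrow> bool"
  where
  "quasisymmetric Z dZ W dW \<eta> f \<longleftrightarrow>
     homeomorphic_map (Metric_space.mtopology Z dZ) (Metric_space.mtopology W dW) f \<and>
     homeomorphic_map (top_of_set {0..}) (top_of_set {0..}) \<eta> \<and>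
     (\<forall>x\<in>Z. \<forall>y\<in>Z. \<forall>z\<in>Z. y \<noteq> z \<longrightarrow>
        dW (f x) (f z) / dW (f y) (f z) \<le> \<eta> (dZ x z / dZ y z))"

text \<open>This is used only for homeomorphisms \<open>f\<close> from \<open>Z\<close> to the space with distance \<open>dW\<close>,
  and for \<open>0 < r < 2 diam Z\<close>.\<close>

definition uniformly_bounded_map ::
  "'a set \<Rightarrow> ('a \<Rightarrow> 'a \<Rightarrow> real) \<Rightarrow> ('b \<Rightarrow> 'b \<Rightarrow> real) \<Rightarrow> real \<Rightarrow> ('a \<Rightarrow> 'b) \<Rightarrow> bool"
  where
  "uniformly_bounded_map Z dZ dW r f \<longleftrightarrow>
     (\<exists>a b :: real. 0 < a \<and> a < b \<and>
        (\<forall>x\<in>Z. ennreal a \<le> ediam dW (f ` Metric_space.mball Z dZ x r) \<and>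
               ediam dW (f ` Metric_space.mball Z dZ x r) \<le> ennreal b))"

end

theory Submission
  imports Defs
begin

text \<open>The diameters of the images of concentric balls of two fixed radii \<open>p\<close> and \<open>q\<close> are
  comparable, uniformly in the centre \<open>x\<close>.  Indeed, uniform perfectness puts a point \<open>y\<close> into
  \<open>B(x,q)\<close> whose distance from \<open>x\<close> is at least a fixed fraction of \<open>q\<close>
  (\<open>uniformly_perfect_far_point\<close>).  For every \<open>z \<in> B(x,p)\<close> the ratio \<open>d(z,x) / d(y,x)\<close> then stays
  in a bounded interval that depends only on \<open>p\<close> and \<open>q\<close>, so quasisymmetry bounds \<open>d(f z, f x)\<close>
  by a constant times \<open>d(f y, f x)\<close>, which is at most the diameter of \<open>f(B(x,q))\<close>
  (\<open>quasisymmetric_ediam_image_ball_le\<close>).  Uniform boundedness passes from \<open>r\<close> to \<open>s\<close> by using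
  this comparison twice: with \<open>(p,q) = (s,r)\<close> for the upper bound, and with \<open>(p,q) = (r,s)\<close> for
  the lower bound.\<close>

lemma ediam_upper: "x \<in> A \<Longrightarrow> y \<in> A \<Longrightarrow> ennreal (d x y) \<le> ediam d A"
  unfolding ediam_def by (rule SUP_upper2[of "(x, y)"]) auto

lemma ediam_least:
  "(\<And>x y. x \<in> A \<Longrightarrow> y \<in> A \<Longrightarrow> ennreal (d x y) \<le> c) \<Longrightarrow> ediam d A \<le> c"
  unfolding ediam_def by (auto intro!: SUP_least)

text \<open>If the ball is not the whole space, uniform perfectness gives the point.  If it is, the
  hypothesis on \<open>q\<close> gives two points at distance greater than \<open>q/2\<close>, and one of them has
  distance greater than \<open>q/4\<close> from \<open>x\<close>; this is the reason for the constant \<open>1/4\<close>.\<close>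

lemma uniformly_perfect_far_point:
  assumes "Metric_space Z d" and "uniformly_perfect Z d \<kappa>" and "x \<in> Z"
    and "0 < q" and "ennreal q < 2 * ediam d Z"
  shows "\<exists>y\<in>Metric_space.mball Z d x q. min (1/\<kappa>) (1/4) * q \<le> d y x"
proof -
  interpret Metric_space Z d by fact
  show ?thesis
  proof (cases "Z - mball x q = {}")
    case False
    then obtain y where y: "y \<in> mball x q" "y \<notin> mball x (q / \<kappa>)"
      using assms unfolding uniformly_perfect_def by blast
    then have "1 / \<kappa> * q \<le> d y x"
      using \<open>x \<in> Z\<close> by (auto simp: commute)
    moreover have "min (1/\<kappa>) (1/4) * q \<le> 1 / \<kappa> * q"
      by (rule mult_right_mono) (use \<open>0 < q\<close> in auto)
    ultimately show ?thesis
      using y(1) by force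
  next
    case True
    have "ennreal (q/2) < ediam d Z"
    proof (rule ccontr)
      assume "\<not> ?thesis"
      then have "2 * ediam d Z \<le> 2 * ennreal (q/2)"
        by (intro mult_left_mono) auto
      also have "\<dots> = ennreal q"
        using \<open>0 < q\<close> ennreal_mult[of 2 "q/2"] by simp
      finally show False
        using assms(5) by simp
    qed
    then obtain u v where uv: "u \<in> Z" "v \<in> Z" "q/2 < d u v"
      unfolding ediam_def less_SUP_iff
      using \<open>0 < q\<close> by (auto simp: ennreal_less_iff)
    have "d u v \<le> d u x + d v x"
      using triangle[of u x v] uv \<open>x \<in> Z\<close> by (simp add: commute)
    then have "q/4 \<le> d u x \<or> q/4 \<le> d v x"
      using uv(3) by linarith
    then obtain y where "y \<in> Z" "q/4 \<le> d y x"
      using uv(1,2) by blast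
    moreover have "min (1/\<kappa>) (1/4) * q \<le> 1/4 * q"
      by (rule mult_right_mono) (use \<open>0 < q\<close> in auto)
    ultimately show ?thesis
      using True by (intro bexI[of _ y]) auto
  qed
qed

text \<open>The bound comes from the compactness of \<open>[0,T]\<close>.  It turns a bound on a ratio of distances
  in \<open>Z\<close> into a bound on the ratio of the distances of the images.\<close>

lemma homeomorphic_map_halfline_bounded:
  fixes \<eta> :: "real \<Rightarrow> real"
  assumes "homeomorphic_map (top_of_set {0..}) (top_of_set {0..}) \<eta>"
  shows "\<exists>M>0. \<forall>t\<in>{0..T}. \<eta> t \<le> M"
proof -
  have "continuous_on {0..} \<eta>"
    using homeomorphic_imp_continuous_map[OF assms]
    by (simp add: continuous_map_in_subtopology)
  then have "continuous_on {0..T} \<eta>"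
    by (rule continuous_on_subset) auto
  then have "bounded (\<eta> ` {0..T})"
    using compact_continuous_image compact_imp_bounded by blast
  then show ?thesis
    unfolding bounded_pos by force
qed

text \<open>The diameter condition on \<open>q\<close> guarantees a point \<open>y \<in> B(x,q)\<close> far from \<open>x\<close>, and
  \<open>d(f y, f x)\<close> is the unit in which distances in \<open>f(B(x,p))\<close> are measured.  If \<open>M\<close> bounds
  these distances from the centre \<open>f x\<close> in that unit, the constant is \<open>2 M\<close> by the triangle
  inequality.\<close>

lemma quasisymmetric_ediam_image_ball_le:
  assumes Z: "Metric_space Z dZ" and W: "Metric_space W dW"
    and \<kappa>: "0 < \<kappa>" "uniformly_perfect Z dZ \<kappa>"
    and qs: "quasisymmetric Z dZ W dW \<eta> f"
    and q: "0 < q" "ennreal q < 2 * ediam dZ Z"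
  shows "\<exists>C>0. \<forall>x\<in>Z. ediam dW (f ` Metric_space.mball Z dZ x p)
    \<le> ennreal C * ediam dW (f ` Metric_space.mball Z dZ x q)"
proof -
  interpret Z: Metric_space Z dZ by fact
  interpret W: Metric_space W dW by fact
  have hom: "homeomorphic_map Z.mtopology W.mtopology f"
    and hom\<eta>: "homeomorphic_map (top_of_set {0..}) (top_of_set {0..}) \<eta>"
    and ratio: "\<And>x y z. x \<in> Z \<Longrightarrow> y \<in> Z \<Longrightarrow> z \<in> Z \<Longrightarrow> y \<noteq> z \<Longrightarrow>
        dW (f x) (f z) / dW (f y) (f z) \<le> \<eta> (dZ x z / dZ y z)"
    using qs unfolding quasisymmetric_def by simp_all
  have fW: "f z \<in> W" if "z \<in> Z" for z
    using homeomorphic_imp_surjective_map[OF hom] that by auto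
  have inj: "inj_on f Z"
    using homeomorphic_imp_injective_map[OF hom] by simp
  define m where "m = min (1/\<kappa>) (1/4) * q"
  have "0 < m"
    using \<kappa>(1) q(1) by (simp add: m_def)
  obtain M where "0 < M" and M: "\<And>t. t \<in> {0..p/m} \<Longrightarrow> \<eta> t \<le> M"
    using homeomorphic_map_halfline_bounded[OF hom\<eta>, of "p/m"] by blast
  have "ediam dW (f ` Z.mball x p) \<le> ennreal (2 * M) * ediam dW (f ` Z.mball x q)"
    if x: "x \<in> Z" for x
  proof -
    obtain y where y: "y \<in> Z.mball x q" "m \<le> dZ y x"
      using uniformly_perfect_far_point[OF Z \<kappa>(2) x q] by (auto simp: m_def)
    have yZ: "y \<in> Z" and "y \<noteq> x"
      using y \<open>0 < m\<close> x by auto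
    then have pos: "0 < dW (f y) (f x)"
      using inj_on_eq_iff[OF inj yZ x] fW[OF yZ] fW[OF x] W.mdist_pos_eq by simp
    have radial: "dW (f z) (f x) \<le> M * dW (f y) (f x)" if z: "z \<in> Z.mball x p" for z
    proof -
      have "0 \<le> p"
        using z Z.nonneg[of x z] unfolding Z.in_mball by linarith
      then have "dZ z x / dZ y x \<le> p / m"
        using z y \<open>0 < m\<close> by (intro frac_le) (auto simp: Z.commute)
      then have "\<eta> (dZ z x / dZ y x) \<le> M"
        by (intro M) auto
      then have "dW (f z) (f x) / dW (f y) (f x) \<le> M"
        using ratio[OF _ yZ x \<open>y \<noteq> x\<close>, of z] z by simp
      then show ?thesis
        using pos by (simp add: pos_divide_le_eq)
    qed
    show ?thesis
    proof (rule ediam_least)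
      fix u' v' assume "u' \<in> f ` Z.mball x p" "v' \<in> f ` Z.mball x p"
      then obtain u v where uv: "u' = f u" "v' = f v" "u \<in> Z.mball x p" "v \<in> Z.mball x p"
        by blast
      have "dW u' v' \<le> dW (f u) (f x) + dW (f v) (f x)"
        using W.triangle[of "f u" "f x" "f v"] uv fW x by (simp add: W.commute)
      also have "\<dots> \<le> 2 * M * dW (f y) (f x)"
        using radial[OF uv(3)] radial[OF uv(4)] by simp
      finally have "ennreal (dW u' v') \<le> ennreal (2 * M) * ennreal (dW (f y) (f x))"
        using \<open>0 < M\<close> by (simp add: ennreal_leI flip: ennreal_mult)
      also have "\<dots> \<le> ennreal (2 * M) * ediam dW (f ` Z.mball x q)"
        using y(1) x q(1) by (intro mult_left_mono ediam_upper) auto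
      finally show "ennreal (dW u' v') \<le> ennreal (2 * M) * ediam dW (f ` Z.mball x q)" .
    qed
  qed
  then show ?thesis
    using \<open>0 < M\<close> by (intro exI[of _ "2 * M"]) auto
qed

theorem proposition1p6:
  fixes Z :: "'a set" and dZ :: "'a \<Rightarrow> 'a \<Rightarrow> real"
    and W :: "'b set" and dW :: "'b \<Rightarrow> 'b \<Rightarrow> real"
    and f :: "'a \<Rightarrow> 'b" and \<eta> :: "real \<Rightarrow> real" and \<kappa> r :: real
  assumes "Metric_space Z dZ" and "\<exists>x\<in>Z. \<exists>y\<in>Z. x \<noteq> y"
    and "Metric_space W dW" and "\<exists>x\<in>W. \<exists>y\<in>W. x \<noteq> y"
    and "1 < \<kappa>" and "uniformly_perfect Z dZ \<kappa>"
    and "quasisymmetric Z dZ W dW \<eta> f"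
    and "0 < r" and "ennreal r < 2 * ediam dZ Z"
    and "uniformly_bounded_map Z dZ dW r f"
  shows "\<forall>s::real. 0 < s \<and> ennreal s < 2 * ediam dZ Z \<longrightarrow> uniformly_bounded_map Z dZ dW s f"
proof (intro allI impI)
  fix s :: real
  assume s: "0 < s \<and> ennreal s < 2 * ediam dZ Z"
  let ?D = "\<lambda>x t. ediam dW (f ` Metric_space.mball Z dZ x t)"
  have comparison: "\<exists>C>0. \<forall>x\<in>Z. ?D x p \<le> ennreal C * ?D x q"
    if "0 < q" "ennreal q < 2 * ediam dZ Z" for p q
    using quasisymmetric_ediam_image_ball_le[OF assms(1,3) _ assms(6,7) that] assms(5) by simp
  obtain a b where ab: "0 < a" "a < b"
      "\<And>x. x \<in> Z \<Longrightarrow> ennreal a \<le> ?D x r" "\<And>x. x \<in> Z \<Longrightarrow> ?D x r \<le> ennreal b"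
    using assms(10) unfolding uniformly_bounded_map_def by blast
  obtain C where C: "0 < C" "\<And>x. x \<in> Z \<Longrightarrow> ?D x s \<le> ennreal C * ?D x r"
    using comparison[OF assms(8,9)] by blast
  obtain C' where C': "0 < C'" "\<And>x. x \<in> Z \<Longrightarrow> ?D x r \<le> ennreal C' * ?D x s"
    using comparison s by blast
  have lower: "ennreal (a / C') \<le> ?D x s" if "x \<in> Z" for x
  proof -
    have "ennreal a \<le> ennreal C' * ?D x s"
      using ab(3) C'(2) that order_trans by blast
    then have "ennreal (1 / C') * ennreal a \<le> ennreal (1 / C') * (ennreal C' * ?D x s)"
      by (rule mult_left_mono) simp
    then show ?thesis
      using C'(1) ab(1) by (simp add: mult.assoc[symmetric] flip: ennreal_mult)
  qed
  \<comment> \<open>The summand \<open>a / C'\<close> serves only to make the two bounds strictly ordered.\<close>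
  have upper: "?D x s \<le> ennreal (C * b + a / C')" if "x \<in> Z" for x
  proof -
    have "?D x s \<le> ennreal C * ennreal b"
      using C(2)[OF that] mult_left_mono[OF ab(4)[OF that], of "ennreal C"] by simp
    also have "\<dots> = ennreal (C * b)"
      using C(1) ab by (simp add: ennreal_mult)
    also have "\<dots> \<le> ennreal (C * b + a / C')"
      using C'(1) ab(1) by (intro ennreal_leI) simp
    finally show ?thesis .
  qed
  have "0 < a / C'" "a / C' < C * b + a / C'"
    using C(1) C'(1) ab(1,2) by auto
  with lower upper show "uniformly_bounded_map Z dZ dW s f"
    unfolding uniformly_bounded_map_def by blast
qed

end
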